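(* Let $y\in\mathbb{R}^M$, let $\Phi$ be a real $M\times N$ matrix with unit-norm columns, let $\lambda,\tau>0$, and let $T_\lambda$ be a thresholding activation function satisfying the conditions listed in the context. If the LCA system $$\tau\dot u(t) = -u(t)-(\Phi^T\Phi-I)\,a(t)+\Phi^T y,\qquad a(t)=T_\lambda(u(t)),$$ converges (i.e. $u(t)\to u^*$ as $t\to+\infty$) to a fixed point $u^*$, with active set $\Gamma_*=\{n:|u_n^*|>\lambda\}$ and inactive set $\Gamma_*^c=\{1,\dots,N\}\setminus\Gamma_*$, such that there exists $r>0$ with $$|u_n^*|\ge\lambda+r\ \text{ for all } n\in\Gamma_*,\qquad |u_n^*|\le\lambda-r\ \text{ for all } n\in\Gamma_*^c,$$ then the system converges after a finite number of switches.
   Context: Activation function: $T_\lambda:\mathbb{R}\to\mathbb{R}$ is given by $T_\lambda(v)=0$ if $|v|\le\lambda$ and $T_\lambda(v)=f(v)$ if $|v|>\lambda$, and is applied to vectors componentwise. Here $f$ is real-valued and continuous on $\mathcal{D}=(-\infty,-\lambda]\cup[\lambda,+\infty)$, differentiable on the interior of $\mathcal{D}$, and satisfies: (a) $f(-v)=-f(v)$ for all $v\in\mathcal{D}$ and $f(\lambda)=0$; (b) $f'(v)>0$ on $\mathcal{D}$ (wherever the derivative is defined, i.e. on the interior); (c) $f(v)\le v$ for all $v\in\mathcal{D}$ with $v\ge 0$. A fixed point of the system is a constant vector $u^*\in\mathbb{R}^N$ with $-u^*-(\Phi^T\Phi-I)T_\lambda(u^* )+\Phi^Ty=0$. Switches: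 the active set at time $t$ is $\Gamma=\{n\in\{1,\dots,N\}:|u_n(t)|>\lambda\}$ and the inactive set is its complement. A switch occurs when a node crosses above or below threshold, so that the active set changes; $\{t_k\}$ denotes the sequence of switching times, $t_k$ being the time at which the system switches from the set of active nodes $\Gamma_{k-1}$ to $\Gamma_k$. In between two switching times the active and inactive sets are fixed. Converging after a finite number of switches means that the sequence of switching times is finite.
   Formalization: The formal theorem assumes that the switching times can be listed as an increasing sequence t_0 < t_1 < … (finite or infinite), so that they do not accumulate at a finite time; under conditions (a)–(c) alone such accumulation can occur and the number of switches is then infinite. *)

theory Defs
  imports "HOL-Analysis.Analysis"
begin

definition threshold_domain :: "real \<Rightarrow> real set" where
  "threshold_domain lam = {..-lam} \<union> {lam..}"

text \<open>Although \<open>f\<close> is a total function here, only its values on the threshold domain are constrained.\<close>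

definition admissible_nonlinearity :: "real \<Rightarrow> (real \<Rightarrow> real) \<Rightarrow> bool" where
  "admissible_nonlinearity lam f \<longleftrightarrow>
     continuous_on (threshold_domain lam) f \<and>
     (\<forall>v\<in>interior (threshold_domain lam). f differentiable (at v)) \<and>
     (\<forall>v\<in>threshold_domain lam. f (- v) = - f v) \<and>
     f lam = 0 \<and>
     (\<forall>v\<in>interior (threshold_domain lam). deriv f v > 0) \<and>
     (\<forall>v\<in>threshold_domain lam. v \<ge> 0 \<longrightarrow> f v \<le> v)"

definition threshold :: "real \<Rightarrow> (real \<Rightarrow> real) \<Rightarrow> real \<Rightarrow> real" where
  "threshold lam f v = (if \<bar>v\<bar> \<le> lam then 0 else f v)"

definition activation :: "real \<Rightarrow> (real \<Rightarrow> real) \<Rightarrow> real ^ 'n \<Rightarrow> real ^ 'n" where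
  "activation lam f x = (\<chi> n. threshold lam f (x $ n))"

definition lca_field ::
    "real ^ 'n ^ 'm \<Rightarrow> real ^ 'm \<Rightarrow> real \<Rightarrow> (real \<Rightarrow> real) \<Rightarrow> real ^ 'n \<Rightarrow> real ^ 'n" where
  "lca_field \<Phi> y lam f x =
     - x - (transpose \<Phi> ** \<Phi> - mat 1) *v activation lam f x + transpose \<Phi> *v y"

text \<open>Time runs over \<open>[0, \<infinity>)\<close>; at \<open>0\<close> the derivative is one-sided.\<close>

definition lca_solution ::
    "real ^ 'n ^ 'm \<Rightarrow> real ^ 'm \<Rightarrow> real \<Rightarrow> (real \<Rightarrow> real) \<Rightarrow> real \<Rightarrow> (real \<Rightarrow> real ^ 'n) \<Rightarrow> bool" where
  "lca_solution \<Phi> y lam f \<tau> u \<longleftrightarrow>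
     (\<forall>t\<ge>0. \<exists>u'. (u has_vector_derivative u') (at t within {0..}) \<and>
                \<tau> *\<^sub>R u' = lca_field \<Phi> y lam f (u t))"

definition lca_fixed_point ::
    "real ^ 'n ^ 'm \<Rightarrow> real ^ 'm \<Rightarrow> real \<Rightarrow> (real \<Rightarrow> real) \<Rightarrow> real ^ 'n \<Rightarrow> bool" where
  "lca_fixed_point \<Phi> y lam f x \<longleftrightarrow> lca_field \<Phi> y lam f x = 0"

definition active_set :: "real \<Rightarrow> real ^ 'n \<Rightarrow> 'n set" where
  "active_set lam x = {n. \<bar>x $ n\<bar> > lam}"

text \<open>The instants at which the active set is not locally constant in time. An instant at which an
  active node merely touches the threshold counts, as the active set changes there.\<close>

definition switching_times :: "real \<Rightarrow> (real \<Rightarrow> real ^ 'n) \<Rightarrow> real set" where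
  "switching_times lam u =
     {t. t \<ge> 0 \<and>
         \<not> (\<forall>\<^sub>F s in at t within {0..}. active_set lam (u s) = active_set lam (u t))}"

lemma active_set_fixed_between_switches:
  assumes ab: "0 \<le> a" and no_switch: "{a<..<b} \<inter> switching_times lam u = {}"
    and s: "s \<in> {a<..<b}" and t: "t \<in> {a<..<b}"
  shows "active_set lam (u s) = active_set lam (u t)"
proof -
  have loc: "\<forall>\<^sub>F x in at c within {a<..<b}. active_set lam (u c) = active_set lam (u x)"
    if c: "c \<in> {a<..<b}" for c
  proof -
    have "\<forall>\<^sub>F x in at c within {0..}. active_set lam (u x) = active_set lam (u c)"
      using that no_switch ab by (auto simp: switching_times_def)
    moreover have "at c within {a<..<b} \<le> at c within {0..}"
      using ab by (intro at_le) auto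
    ultimately show ?thesis
      by (auto simp: le_filter_def eq_commute)
  qed
  show ?thesis
    by (rule connected_local_const[where A = "{a<..<b}"]) (use s t loc in auto)
qed

text \<open>The switching times \<open>t 0 < t 1 < \<dots>\<close> (with \<open>t k\<close> for \<open>k < K\<close>) listed in temporal order,
  where \<open>K = \<infinity>\<close> stands for an infinite sequence. That such a sequence exists is a condition on
  the trajectory: since the set of switching times is closed, it says that they do not
  accumulate at a finite time.\<close>

definition switching_sequence ::
    "real \<Rightarrow> (real \<Rightarrow> real ^ 'n) \<Rightarrow> enat \<Rightarrow> (nat \<Rightarrow> real) \<Rightarrow> bool" where
  "switching_sequence lam u K t \<longleftrightarrow>
     strict_mono_on {k. enat k < K} t \<and> t ` {k. enat k < K} = switching_times lam u"

end

theory Submission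
  imports Defs
begin

text \<open>Near \<open>u_star\<close> the margin \<open>r\<close> freezes the active set, so switching stops after a finite
  time and an infinite strictly increasing sequence of switching times would converge. Its limit
  would be a switching time, since these form a closed set, but it exceeds every term of the
  sequence that enumerates them.\<close>

text \<open>An open set is a neighbourhood of each of its points, so it witnesses local constancy at
  all of them. Times \<open>s < 0\<close> may be ignored because the filter lives within
  \<open>{0..}\<close>. Used below both for closedness and for boundedness.\<close>

lemma switching_times_disjoint_open:
  assumes "open S" and const: "\<And>s. s \<in> S \<Longrightarrow> s \<ge> 0 \<Longrightarrow> active_set lam (u s) = A"
  shows "S \<inter> switching_times lam u = {}"
proof (rule equals0I)
  fix t assume t: "t \<in> S \<inter> switching_times lam u"
  then have "t \<ge> 0" by (simp add: switching_times_def)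
  have "\<forall>\<^sub>F s in at t within {0..}. active_set lam (u s) = active_set lam (u t)"
    unfolding eventually_at_topological
    using t \<open>t \<ge> 0\<close> \<open>open S\<close> const by (intro exI[of _ S]) auto
  then show False
    using t by (simp add: switching_times_def)
qed

text \<open>Local constancy is an open condition: a neighbourhood witnessing it at \<open>t\<close>
  also witnesses it at each of its other points.\<close>

lemma closed_switching_times: "closed (switching_times lam u)"
  unfolding closed_def open_subopen[of "- switching_times lam u"]
proof
  fix t assume t: "t \<in> - switching_times lam u"
  show "\<exists>S. open S \<and> t \<in> S \<and> S \<subseteq> - switching_times lam u"
  proof (cases "t \<ge> 0")
    case True
    with t have "\<forall>\<^sub>F s in at t within {0..}. active_set lam (u s) = active_set lam (u t)"
      by (simp add: switching_times_def)
    then obtain S where S: "open S" "t \<in> S"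
      "\<And>s. s \<in> S \<Longrightarrow> s \<noteq> t \<Longrightarrow> s \<ge> 0 \<Longrightarrow> active_set lam (u s) = active_set lam (u t)"
      unfolding eventually_at_topological by auto
    \<comment> \<open>The punctured filter says nothing about \<open>t\<close> itself, where the
      equation is trivial.\<close>
    then have "active_set lam (u s) = active_set lam (u t)" if "s \<in> S" "s \<ge> 0" for s
      using that by (cases "s = t") auto
    with \<open>open S\<close> have "S \<inter> switching_times lam u = {}"
      by (rule switching_times_disjoint_open)
    with S(1,2) show ?thesis
      by (intro exI[of _ S]) auto
  next
    case False
    then show ?thesis
      by (intro exI[of _ "{..<0}"]) (auto simp: switching_times_def)
  qed
qed

text \<open>Once \<open>u s\<close> is within \<open>r\<close> of \<open>u_star\<close>, each
  coordinate moves by strictly less than its distance to the threshold, so none can cross or reach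
  it.\<close>

lemma eventually_active_set_eq:
  fixes u :: "real \<Rightarrow> real ^ 'n"
  assumes conv: "(u \<longlongrightarrow> u_star) F" and "r > 0"
    and active: "\<And>n. n \<in> active_set lam u_star \<Longrightarrow> \<bar>u_star $ n\<bar> \<ge> lam + r"
    and inactive: "\<And>n. n \<in> - active_set lam u_star \<Longrightarrow> \<bar>u_star $ n\<bar> \<le> lam - r"
  shows "\<forall>\<^sub>F s in F. active_set lam (u s) = active_set lam u_star"
proof -
  have "\<forall>\<^sub>F s in F. dist (u s) u_star < r"
    using conv \<open>r > 0\<close> by (rule tendstoD)
  then show ?thesis
  proof eventually_elim
    case (elim s)
    have close: "\<bar>u s $ n - u_star $ n\<bar> < r" for n
      using component_le_norm_cart[of "u s - u_star" n] elim by (simp add: dist_norm)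
    have "\<bar>u s $ n\<bar> > lam \<longleftrightarrow> n \<in> active_set lam u_star" for n
      using close[of n] active[of n] inactive[of n] by fastforce
    then show ?case
      unfolding active_set_def by blast
  qed
qed

lemma bdd_above_switching_times:
  assumes "\<forall>\<^sub>F s in at_top. active_set lam (u s) = A"
  shows "bdd_above (switching_times lam u)"
proof -
  obtain b where "\<And>s. s \<ge> b \<Longrightarrow> active_set lam (u s) = A"
    using assms by (auto simp: eventually_at_top_linorder)
  \<comment> \<open>The half-line is taken open at \<open>b\<close>, since a switch may still occur
    at \<open>b\<close> itself.\<close>
  then have "{b<..} \<inter> switching_times lam u = {}"
    by (intro switching_times_disjoint_open) auto
  then show ?thesis
    by (intro bdd_aboveI[of _ b]) (auto simp: disjoint_iff not_less)
qed

lemma switching_sequence_finite: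
  assumes seq: "switching_sequence lam u K t" and bdd: "bdd_above (switching_times lam u)"
  shows "K < \<infinity>"
proof (rule ccontr)
  assume "\<not> K < \<infinity>"
  \<comment> \<open>For \<open>K = \<infinity>\<close> the index set \<open>{k. enat k < K}\<close>
    is all of \<open>nat\<close>.\<close>
  with seq have mono: "strict_mono t" and range: "range t = switching_times lam u"
    by (auto simp: switching_sequence_def)
  \<comment> \<open>A nonempty closed set bounded above contains its supremum, so the sequence would
    have a largest term \<open>t j\<close>, which \<open>t (Suc j)\<close> exceeds.\<close>
  have "(SUP k. t k) \<in> switching_times lam u"
    unfolding range
    by (rule closed_contains_Sup[OF _ bdd closed_switching_times]) (use range in blast)
  with range obtain j where "(SUP k. t k) = t j" by auto
  moreover have "t (Suc j) \<le> (SUP k. t k)"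
    using bdd range by (intro cSUP_upper) auto
  moreover have "t j < t (Suc j)"
    using mono by (simp add: strict_mono_def)
  ultimately show False by simp
qed

theorem theorem2:
  fixes \<Phi> :: "real ^ 'n ^ 'm" and y :: "real ^ 'm"
    and lam \<tau> r :: real and f :: "real \<Rightarrow> real"
    and u :: "real \<Rightarrow> real ^ 'n" and u_star :: "real ^ 'n"
    and K :: enat and t :: "nat \<Rightarrow> real"
  assumes unit_columns: "\<And>n. norm (column n \<Phi>) = 1"
    and "lam > 0" and "\<tau> > 0"
    and "admissible_nonlinearity lam f"
    and "lca_solution \<Phi> y lam f \<tau> u"
    and "lca_fixed_point \<Phi> y lam f u_star"
    and "(u \<longlongrightarrow> u_star) at_top"
    and "r > 0"
    and "\<And>n. n \<in> active_set lam u_star \<Longrightarrow> \<bar>u_star $ n\<bar> \<ge> lam + r"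
    and "\<And>n. n \<in> - active_set lam u_star \<Longrightarrow> \<bar>u_star $ n\<bar> \<le> lam - r"
    and "switching_sequence lam u K t"
  shows "K < \<infinity>"
  using assms(11) bdd_above_switching_times[OF eventually_active_set_eq[OF assms(7-10)]]
  by (rule switching_sequence_finite)

end
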